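(* Let $n\ge 1$ and let $k_1<k_2<\cdots<k_n$ be integers. Then the generating function $\sum_{T} Q^{\mathrm{inv}(T)}$, where $T$ ranges over all monotone triangles with bottom row $(k_1,\ldots,k_n)$ and $\mathrm{inv}(T)$ is the number of entries $a_{i,j}$ of $T$ with $i\neq 1$ and $a_{i-1,j-1}<a_{i,j}<a_{i-1,j}$, is equal to $$\prod_{1\le s<t\le n}\left(\mathrm{id}-(2-Q)E_{k_s}+E_{k_s}E_{k_t}\right)\prod_{1\le i<j\le n}\frac{k_j-k_i}{j-i},$$ where the operator is applied to the polynomial $\prod_{1\le i<j\le n}\frac{k_j-k_i}{j-i}$ in the variables $k_1,\ldots,k_n$ and the result is evaluated at the given integers $k_1,\ldots,k_n$.
   Context: A monotone triangle with $n$ rows is a triangular array of integers $(a_{i,j})_{1\le i\le j\le n}$ (row $i$ consists of $a_{i,i},\ldots,a_{i,n}$; row $1$ is the bottom row $(a_{1,1},\ldots,a_{1,n})$, row $n$ is the single top entry $a_{n,n}$) such that $a_{i,j}\le a_{i+1,j+1}$ for $1\le i\le j<n$, $a_{i,j}\le a_{i-1,j}$ for $1<i\le j\le n$, and $a_{i,j}<a_{i,j+1}$ for $1\le i\le j\le n-1$. $E_x$ denotes the shift operator $E_x p(x)=p(x+1)$ in the variable $x$; a product of operators means their composition (shift operators in different variables commute). $Q$ is an indeterminate. *)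

theory Defs
  imports "HOL-Computational_Algebra.Polynomial" "HOL-Library.FuncSet"
begin

text \<open>
  An array is a function \<open>a i j\<close> that is normalised to 0 off the index range \<open>1 \<le> i \<le> j \<le> n\<close>,
  so that distinct functions are distinct triangles and the set of triangles with a given
  bottom row is finite (see \<open>finite_monotone_triangles\<close>). Row 1 is the bottom row.
\<close>

definition monotone_triangle :: "nat \<Rightarrow> (nat \<Rightarrow> nat \<Rightarrow> int) \<Rightarrow> bool" where
  "monotone_triangle n a \<longleftrightarrow>
     (\<forall>i j. 1 \<le> i \<and> i \<le> j \<and> j < n \<longrightarrow> a i j \<le> a (i + 1) (j + 1)) \<and>
     (\<forall>i j. 1 < i \<and> i \<le> j \<and> j \<le> n \<longrightarrow> a i j \<le> a (i - 1) j) \<and>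
     (\<forall>i j. 1 \<le> i \<and> i \<le> j \<and> j < n \<longrightarrow> a i j < a i (j + 1)) \<and>
     (\<forall>i j. \<not> (1 \<le> i \<and> i \<le> j \<and> j \<le> n) \<longrightarrow> a i j = 0)"

definition monotone_triangles :: "nat \<Rightarrow> (nat \<Rightarrow> int) \<Rightarrow> (nat \<Rightarrow> nat \<Rightarrow> int) set" where
  "monotone_triangles n k = {a. monotone_triangle n a \<and> (\<forall>j\<in>{1..n}. a 1 j = k j)}"

definition triangle_inv :: "nat \<Rightarrow> (nat \<Rightarrow> nat \<Rightarrow> int) \<Rightarrow> nat" where
  "triangle_inv n a =
     card {(i, j). 1 < i \<and> i \<le> j \<and> j \<le> n \<and> a (i - 1) (j - 1) < a i j \<and> a i j < a (i - 1) j}"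

lemma monotone_triangles_bounds:
  assumes "a \<in> monotone_triangles n k" "1 \<le> i" "i \<le> j" "j \<le> n"
  shows "a i j \<in> {k (j + 1 - i)..k j}"
  using assms(2-)
proof (induction i arbitrary: j rule: dec_induct)
  case base
  then show ?case using assms(1) by (auto simp: monotone_triangles_def)
next
  case (step m)
  have m: "monotone_triangle n a"
    using assms(1) by (simp add: monotone_triangles_def)
  have "a i j \<le> a (i + 1) (j + 1)" if "1 \<le> i" "i \<le> j" "j < n" for i j
    using m that unfolding monotone_triangle_def by blast
  from this[of m "j - 1"] have "a m (j - 1) \<le> a (m + 1) j"
    using step.hyps(1) step.prems by simp
  moreover have "a i j \<le> a (i - 1) j" if "1 < i" "i \<le> j" "j \<le> n" for i j
    using m that unfolding monotone_triangle_def by blast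
  from this[of "m + 1" j] have "a (m + 1) j \<le> a m j"
    using step.hyps(1) step.prems by simp
  moreover have "a m (j - 1) \<in> {k (j - 1 + 1 - m)..k (j - 1)}" "a m j \<in> {k (j + 1 - m)..k j}"
    using step.IH[of "j - 1"] step.IH[of j] step.prems by auto
  ultimately show ?case using step.prems by auto
qed

lemma finite_monotone_triangles: "finite (monotone_triangles n k)"
proof -
  define D where "D = {(i, j). 1 \<le> i \<and> i \<le> j \<and> j \<le> (n::nat)}"
  define r where "r a = restrict (\<lambda>(i, j). a i j) D" for a :: "nat \<Rightarrow> nat \<Rightarrow> int"
  have "D \<subseteq> {..n} \<times> {..n}" by (auto simp: D_def)
  then have "finite D" by (rule finite_subset) simp
  then have "finite (PiE D (\<lambda>(i, j). {k (j + 1 - i)..k j}))"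
    by (intro finite_PiE) auto
  moreover have "r ` monotone_triangles n k \<subseteq> PiE D (\<lambda>(i, j). {k (j + 1 - i)..k j})"
    using monotone_triangles_bounds by (fastforce simp: r_def D_def)
  ultimately have "finite (r ` monotone_triangles n k)" by (rule rev_finite_subset)
  moreover have "inj_on r (monotone_triangles n k)"
  proof (rule inj_onI, intro ext)
    fix a b i j
    assume ab: "a \<in> monotone_triangles n k" "b \<in> monotone_triangles n k" "r a = r b"
    show "a i j = b i j"
    proof (cases "(i, j) \<in> D")
      case True
      then show ?thesis using fun_cong[OF ab(3), of "(i, j)"] by (simp add: r_def)
    next
      case False
      then show ?thesis using ab
        by (simp add: monotone_triangles_def monotone_triangle_def D_def)
    qed
  qed
  ultimately show ?thesis by (rule finite_imageD)
qed

text \<open>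
  Polynomials in the variables \<open>k 1, \<dots>, k n\<close> with coefficients in \<open>\<rat>[Q]\<close> are represented by
  the polynomial functions they induce on rational arguments; as \<open>\<rat>\<close> is infinite, nothing is
  lost. The indeterminate \<open>Q\<close> is the variable of \<^typ>\<open>rat poly\<close>.
\<close>

abbreviation Q :: "rat poly" where
  "Q \<equiv> [:0, 1:]"

definition shift :: "nat \<Rightarrow> ((nat \<Rightarrow> rat) \<Rightarrow> rat poly) \<Rightarrow> ((nat \<Rightarrow> rat) \<Rightarrow> rat poly)" where
  "shift s f = (\<lambda>k. f (k(s := k s + 1)))"

definition factor_op ::
    "nat \<Rightarrow> nat \<Rightarrow> ((nat \<Rightarrow> rat) \<Rightarrow> rat poly) \<Rightarrow> ((nat \<Rightarrow> rat) \<Rightarrow> rat poly)" where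
  "factor_op s t f = (\<lambda>k. f k - (2 - Q) * shift s f k + shift s (shift t f) k)"

text \<open>
  The composition of all \<open>factor_op s t\<close> with \<open>1 \<le> s < t \<le> n\<close>, taken in lexicographic order;
  by \<open>factor_op_commute\<close> the order is immaterial.
\<close>

lemma shift_commute: "shift s (shift t f) = shift t (shift s f)"
  by (cases "s = t") (auto simp: shift_def fun_upd_twist)

lemma factor_op_commute: "factor_op s t \<circ> factor_op u v = factor_op u v \<circ> factor_op s t"
proof -
  have lin: "shift x (\<lambda>k. g k - c * h k + l k) =
      (\<lambda>k. shift x g k - c * shift x h k + shift x l k)" for x g c h l
    by (simp add: shift_def)
  show ?thesis
    unfolding factor_op_def comp_def lin
    unfolding shift_commute[of u s] shift_commute[of v s] shift_commute[of u t]
      shift_commute[of v t]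
    by (intro ext) (simp only: algebra_simps)
qed

definition product_op ::
    "nat \<Rightarrow> ((nat \<Rightarrow> rat) \<Rightarrow> rat poly) \<Rightarrow> ((nat \<Rightarrow> rat) \<Rightarrow> rat poly)" where
  "product_op n =
     foldr (\<circ>) [factor_op s t. s \<leftarrow> [1..<n + 1], t \<leftarrow> [s + 1..<n + 1]] id"

definition vandermonde_poly :: "nat \<Rightarrow> (nat \<Rightarrow> rat) \<Rightarrow> rat poly" where
  "vandermonde_poly n k =
     [:\<Prod>(i, j)\<in>{(i, j). 1 \<le> i \<and> i < j \<and> j \<le> n}. (k j - k i) / (of_nat j - of_nat i):]"

end

theory Submission
  imports Defs "Jordan_Normal_Form.Determinant"
begin

text \<open>
  Deleting the bottom row expresses the generating function as a weighted sum, over the strictly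
  increasing rows interlacing with \<open>k\<close>, of the generating function one size smaller, so the
  right-hand side \<open>\<alpha> n\<close> has to satisfy the same recursion. Write \<open>W s t\<close> for the factors of the
  operator and let \<open>G\<close> be the determinant of the binomial coefficients \<open>x i gchoose j\<close>
  with \<open>1 \<le> i, j \<le> n\<close>. Applying the difference operator in every variable turns \<open>G\<close> into the
  determinant of the \<open>x i gchoose (j - 1)\<close>, which is the Vandermonde product; hence it turns
  \<open>B = (\<Prod>s<t. W s t) G\<close> into \<open>\<alpha> n\<close>, and each one-variable sum of \<open>\<alpha> n\<close> telescopes to a term
  at its left and a term at its right endpoint. When slot \<open>i\<close> takes its right and slot \<open>i + 1\<close> its
  left endpoint, the resulting term, corrected by the forbidden rows with equal entries in these
  slots, is \<open>- Q\<close> times \<open>W (i + 1) i B\<close> at a point with \<open>x i = x (i + 1)\<close>. This vanishes: since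
  \<open>W (i + 1) i\<close> completes the operator to one symmetric in the two variables, \<open>W (i + 1) i B\<close> is
  antisymmetric in them. What survives are \<open>n + 1\<close> terms, the \<open>r\<close>-th one omitting the variable
  \<open>k r\<close>; they match the expansion along the first column of the determinant behind
  \<open>\<alpha> (n + 1)\<close>, as shifting \<open>k r\<close> does nothing to a minor not containing it.
\<close>

subsection \<open>Products of commuting shift operators\<close>

type_synonym fn = "(nat \<Rightarrow> rat) \<Rightarrow> rat poly"

definition ops :: "(nat \<times> nat) set \<Rightarrow> fn \<Rightarrow> fn" where
  "ops P f = Finite_Set.fold (\<lambda>(s, t). factor_op s t) f P"

definition pairs :: "nat \<Rightarrow> (nat \<times> nat) set" where
  "pairs n = {(s, t). 1 \<le> s \<and> s < t \<and> t \<le> n}"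

lemma finite_pairs [simp]: "finite (pairs n)"
  by (rule finite_subset[of _ "{..n} \<times> {..n}"]) (auto simp: pairs_def)

interpretation factor_op: comp_fun_commute "\<lambda>(s, t). factor_op s t"
  by unfold_locales (auto simp: factor_op_commute)

lemma ops_empty [simp]: "ops {} f = f"
  by (simp add: ops_def)

lemma ops_insert:
  "finite P \<Longrightarrow> (s, t) \<notin> P \<Longrightarrow> ops (insert (s, t) P) f = factor_op s t (ops P f)"
  by (simp add: ops_def)

lemma ops_union:
  "finite P \<Longrightarrow> finite R \<Longrightarrow> P \<inter> R = {} \<Longrightarrow> ops (P \<union> R) f = ops P (ops R f)"
proof (induction P rule: finite_induct)
  case (insert p P)
  then show ?case by (cases p) (simp add: ops_insert)
qed simp

text \<open>An operator \<open>T\<close> that intertwines the single factors intertwines their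
  product. It serves with \<open>h = id\<close>, where \<open>T\<close> commutes with every factor,
  and for the renaming of variables in \<open>ops_reindex\<close>.\<close>

lemma ops_transport:
  assumes "finite P" "inj_on h P"
    and "\<And>s t g. (s, t) \<in> P \<Longrightarrow> T (factor_op s t g) = factor_op (fst (h (s, t))) (snd (h (s, t))) (T g)"
  shows "T (ops P f) = ops (h ` P) (T f)"
  using assms
proof (induction P rule: finite_induct)
  case (insert p P)
  then show ?case
    by (cases p; cases "h p") (auto simp: ops_insert)
qed simp

lemma ops_commute:
  assumes "finite P" "\<And>s t g. (s, t) \<in> P \<Longrightarrow> T (factor_op s t g) = factor_op s t (T g)"
  shows "T (ops P f) = ops P (T f)"
  using ops_transport[of P id T f] assms by simp

lemma factor_op_sum:
  "factor_op s t (\<lambda>x. \<Sum>r\<in>I. c r * f r x) = (\<lambda>x. \<Sum>r\<in>I. c r * factor_op s t (f r) x)"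
  by (simp add: factor_op_def shift_def fun_eq_iff sum_distrib_left sum_subtractf sum.distrib
      algebra_simps)

lemma ops_sum:
  assumes "finite P"
  shows "ops P (\<lambda>x. \<Sum>r\<in>I. c r * f r x) = (\<lambda>x. \<Sum>r\<in>I. c r * ops P (f r) x)"
  using assms
proof (induction P rule: finite_induct)
  case (insert p P)
  then show ?case by (cases p) (simp add: ops_insert factor_op_sum)
qed simp

lemma factor_op_reindex:
  assumes "inj h"
  shows "(\<lambda>x. factor_op s t f (x \<circ> h)) = factor_op (h s) (h t) (\<lambda>x. f (x \<circ> h))"
proof -
  have "x(h s := v) \<circ> h = (x \<circ> h)(s := v)" for x :: "nat \<Rightarrow> rat" and s v
    using assms by (auto simp: fun_eq_iff inj_eq)
  then have "shift (h s) (\<lambda>x. f (x \<circ> h)) = (\<lambda>x. shift s f (x \<circ> h))" for s and f :: fn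
    by (simp add: shift_def)
  then show ?thesis
    by (simp add: factor_op_def)
qed

lemma ops_reindex:
  assumes "inj h" "finite P"
  shows "(\<lambda>x. ops P f (x \<circ> h)) = ops (map_prod h h ` P) (\<lambda>x. f (x \<circ> h))"
  by (rule ops_transport[where T = "\<lambda>f x. f (x \<circ> h)"])
    (use assms in \<open>auto simp: factor_op_reindex prod.inj_map inj_on_subset[OF prod.inj_map]\<close>)

lemma foldr_factor_op:
  "distinct ps \<Longrightarrow> foldr (\<circ>) (map (\<lambda>(s, t). factor_op s t) ps) id f = ops (set ps) f"
  by (induction ps) (auto simp: ops_insert)

lemma product_op_eq_ops: "product_op n f = ops (pairs n) f"
proof -
  let ?ps = "concat (map (\<lambda>s. map (Pair s) [s + 1..<n + 1]) [1..<n + 1])"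
  have "product_op n f = foldr (\<circ>) (map (\<lambda>(s, t). factor_op s t) ?ps) id f"
    by (simp add: product_op_def map_concat o_def)
  also have "distinct ?ps"
  proof (rule distinct_concat)
    have "inj_on (\<lambda>s. map (Pair s) [s + 1..<n + 1]) {1..<n + 1}"
    proof (rule inj_onI)
      fix s t
      assume *: "s \<in> {1..<n + 1}" "t \<in> {1..<n + 1}"
        "map (Pair s) [s + 1..<n + 1] = map (Pair t) [t + 1..<n + 1]"
      from arg_cong[OF *(3), of length] *(1,2) show "s = t" by (auto simp del: upt_Suc)
    qed
    then show "distinct (map (\<lambda>s. map (Pair s) [s + 1..<n + 1]) [1..<n + 1])"
      by (simp add: distinct_map del: upt_Suc)
  qed (auto simp: distinct_map inj_on_def simp del: upt_Suc)
  then have "foldr (\<circ>) (map (\<lambda>(s, t). factor_op s t) ?ps) id f = ops (set ?ps) f"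
    by (rule foldr_factor_op)
  also have "set ?ps = pairs n"
    by (auto simp: pairs_def image_iff)
  finally show ?thesis .
qed

lemma factor_op_upd:
  assumes "j \<noteq> s" "j \<noteq> t"
  shows "factor_op s t (\<lambda>y. f (y(j := v))) = (\<lambda>x. factor_op s t f (x(j := v)))"
  using assms by (simp add: factor_op_def shift_def fun_eq_iff fun_upd_twist)

text \<open>The factors shift only the variables \<open>1, ..., n\<close>, so clearing the other
  coordinates commutes with them. This lets the \<open>k\<close> of the theorem be replaced by one
  that vanishes off \<open>{1..n}\<close>.\<close>

lemma ops_restrict:
  assumes "\<And>x. f (\<lambda>i. if i \<in> {1..n} then x i else 0) = f x"
  shows "ops (pairs n) f (\<lambda>i. if i \<in> {1..n} then x i else 0) = ops (pairs n) f x"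
proof -
  define R where "R x = (\<lambda>i. if i \<in> {1..n} then x i else 0)" for x :: "nat \<Rightarrow> rat"
  have R: "shift i (\<lambda>x. g (R x)) = (\<lambda>x. shift i g (R x))" if "i \<in> {1..n}" for i and g :: fn
  proof -
    have "R (x(i := x i + 1)) = (R x)(i := R x i + 1)" for x
      using that by (auto simp: R_def)
    then show ?thesis by (simp add: shift_def)
  qed
  have "(\<lambda>x. ops (pairs n) f (R x)) = ops (pairs n) (\<lambda>x. f (R x))"
    by (rule ops_commute[where T = "\<lambda>f x. f (R x)"])
      (simp, auto simp: factor_op_def pairs_def R)
  also have "(\<lambda>x. f (R x)) = f"
    using assms by (simp add: R_def)
  finally show ?thesis by (simp add: R_def fun_eq_iff)
qed

subsection \<open>Difference operators\<close>

definition diff :: "nat \<Rightarrow> fn \<Rightarrow> fn" where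
  "diff s f = (\<lambda>x. shift s f x - f x)"

primrec differences :: "nat \<Rightarrow> fn \<Rightarrow> fn" where
  "differences 0 f = f"
| "differences (Suc m) f = differences m (diff (Suc m) f)"

lemma diff_factor_op: "diff i (factor_op s t f) = factor_op s t (diff i f)"
proof -
  have lin: "shift x (\<lambda>k. g k - c * h k + l k) =
      (\<lambda>k. shift x g k - c * shift x h k + shift x l k)" for x g c h l
    by (simp add: shift_def)
  have lin': "shift x (\<lambda>k. g k - h k) = (\<lambda>k. shift x g k - shift x h k)" for x and g h :: fn
    by (simp add: shift_def)
  show ?thesis
    unfolding factor_op_def diff_def lin lin'
    unfolding shift_commute[of i s] shift_commute[of i t]
    by (intro ext) (simp only: algebra_simps)
qed

lemma differences_commute:
  assumes "\<And>i g. 1 \<le> i \<Longrightarrow> i \<le> m \<Longrightarrow> T (diff i g) = diff i (T g)"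
  shows "T (differences m f) = differences m (T f)"
  using assms by (induction m arbitrary: f) auto

lemma differences_ops:
  assumes "finite P"
  shows "differences m (ops P f) = ops P (differences m f)"
  by (rule differences_commute[symmetric])
    (rule ops_commute[OF assms diff_factor_op, symmetric])

lemma diff_upd:
  assumes "j \<noteq> i"
  shows "diff i (\<lambda>y. f (y(j := v))) = (\<lambda>x. diff i f (x(j := v)))"
  using assms by (simp add: diff_def shift_def fun_eq_iff fun_upd_twist)

lemma diff_sum:
  "diff i (\<lambda>x. \<Sum>r\<in>I. c r * f r x) = (\<lambda>x. \<Sum>r\<in>I. c r * diff i (f r) x)"
  by (simp add: diff_def shift_def fun_eq_iff sum_subtractf algebra_simps)

subsection \<open>Summation over interlacing rows\<close>

text \<open>\<open>l i\<close> is the entry in row 2 and column \<open>Suc i\<close> of a triangle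
  with bottom row \<open>k\<close>; the index is lowered by one so that \<open>l\<close> is itself a
  bottom row starting at index 1.\<close>

definition interlacing :: "nat \<Rightarrow> (nat \<Rightarrow> int) \<Rightarrow> (nat \<Rightarrow> int) set" where
  "interlacing m k = {l. (\<forall>i\<in>{1..m}. k i \<le> l i \<and> l i \<le> k (Suc i)) \<and>
     (\<forall>i. 1 \<le> i \<and> i < m \<longrightarrow> l i < l (Suc i)) \<and> (\<forall>i. i \<notin> {1..m} \<longrightarrow> l i = 0)}"

definition weight :: "nat \<Rightarrow> (nat \<Rightarrow> int) \<Rightarrow> (nat \<Rightarrow> int) \<Rightarrow> rat poly" where
  "weight m k l = (\<Prod>i\<in>{1..m}. if k i < l i \<and> l i < k (Suc i) then Q else 1)"

definition row_sum :: "nat \<Rightarrow> (nat \<Rightarrow> int) \<Rightarrow> fn \<Rightarrow> rat poly" where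
  "row_sum m k A = (\<Sum>l\<in>interlacing m k. weight m k l * A (\<lambda>i. of_int (l i)))"

text \<open>Sums out slot \<open>m\<close> alone, without demanding that its entry exceed the
  previous one.\<close>

definition slot_sum :: "(nat \<Rightarrow> int) \<Rightarrow> nat \<Rightarrow> fn \<Rightarrow> fn" where
  "slot_sum k m A = (\<lambda>x. \<Sum>v\<in>{k m..k (Suc m)}.
     (if k m < v \<and> v < k (Suc m) then Q else 1) * A (x(m := of_int v)))"

lemma finite_interlacing [simp]: "finite (interlacing m k)"
proof -
  define r where "r = (\<lambda>l :: nat \<Rightarrow> int. restrict l {1..m})"
  have "r ` interlacing m k \<subseteq> PiE {1..m} (\<lambda>i. {k i..k (Suc i)})"
    by (auto simp: r_def interlacing_def)
  moreover have "finite (PiE {1..m} (\<lambda>i. {k i..k (Suc i)}))"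
    by (intro finite_PiE) auto
  ultimately have "finite (r ` interlacing m k)"
    by (rule finite_subset)
  moreover have "inj_on r (interlacing m k)"
  proof (rule inj_onI, rule ext)
    fix l l' i assume *: "l \<in> interlacing m k" "l' \<in> interlacing m k" "r l = r l'"
    show "l i = l' i"
    proof (cases "i \<in> {1..m}")
      case True
      then show ?thesis using fun_cong[OF *(3), of i] unfolding r_def by simp
    next
      case False
      then show ?thesis using *(1,2) by (simp add: interlacing_def)
    qed
  qed
  ultimately show ?thesis by (rule finite_imageD)
qed

lemma interlacing_0: "interlacing 0 k = {\<lambda>_. 0}"
  by (auto simp: interlacing_def)

lemma weight_Suc_upd:
  "weight (Suc m) k (l(Suc m := v)) =
     (if k (Suc m) < v \<and> v < k (Suc (Suc m)) then Q else 1) * weight m k l"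
proof -
  have "weight m k (l(Suc m := v)) = weight m k l"
    unfolding weight_def by (rule prod.cong) auto
  then show ?thesis by (simp add: weight_def)
qed

lemma of_int_upd: "(\<lambda>i. of_int ((l(j := v)) i)) = (\<lambda>i. of_int (l i))(j := of_int v)"
  by auto

lemma interlacing_cut:
  "l \<in> interlacing (Suc m) k \<Longrightarrow> l(Suc m := 0) \<in> interlacing m k"
  by (auto simp: interlacing_def)

lemma row_sum_slot_sum:
  "row_sum m k (slot_sum k (Suc m) A) =
     (\<Sum>(l, v)\<in>interlacing m k \<times> {k (Suc m)..k (Suc (Suc m))}.
        weight (Suc m) k (l(Suc m := v)) * A (\<lambda>i. of_int ((l(Suc m := v)) i)))"
  unfolding row_sum_def slot_sum_def weight_Suc_upd of_int_upd
  by (simp add: sum.cartesian_product sum_distrib_left mult_ac)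

text \<open>A row is split into its last entry and the rest. Compared with
  \<open>row_sum_slot_sum\<close> only the condition \<open>l m < v\<close> is added, so the two
  sums differ by the pairs violating it.\<close>

lemma row_sum_Suc:
  "row_sum (Suc m) k A =
     (\<Sum>(l, v)\<in>{(l, v) \<in> interlacing m k \<times> {k (Suc m)..k (Suc (Suc m))}. m = 0 \<or> l m < v}.
        weight (Suc m) k (l(Suc m := v)) * A (\<lambda>i. of_int ((l(Suc m := v)) i)))"
  unfolding row_sum_def
proof (rule sum.reindex_bij_witness
    [where i = "\<lambda>(l, v). l(Suc m := v)" and j = "\<lambda>l. (l(Suc m := 0), l (Suc m))"], goal_cases)
  case (2 l)
  then have "l(Suc m := 0) \<in> interlacing m k"
    by (rule interlacing_cut)
  moreover have "m = 0 \<or> l m < l (Suc m)"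
    using 2 by (cases m) (auto simp: interlacing_def)
  ultimately show ?case using 2 by (auto simp: interlacing_def)
next
  case (3 p)
  then show ?case by (auto simp: interlacing_def fun_eq_iff)
next
  case (4 p)
  then show ?case
    by (auto simp: interlacing_def le_Suc_eq less_Suc_eq)
next
  case (5 l)
  have "(l(Suc m := 0))(Suc m := l (Suc m)) = l" by simp
  then show ?case by (simp only: prod.case)
qed auto

lemma row_sum_1: "row_sum (Suc 0) k A = row_sum 0 k (slot_sum k (Suc 0) A)"
  unfolding row_sum_Suc row_sum_slot_sum by (rule sum.cong) auto

text \<open>Two adjacent entries of a row can only coincide at the entry of the row below that lies
  between them; since that row is strictly increasing, such coincidences do not interact.\<close>

lemma row_sum_Suc_Suc:
  fixes k :: "nat \<Rightarrow> int"
  assumes k: "\<And>i. 1 \<le> i \<Longrightarrow> i \<le> Suc (Suc m) \<Longrightarrow> k i < k (Suc i)"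
  defines "v \<equiv> rat_of_int (k (Suc (Suc m)))"
  shows "row_sum (Suc (Suc m)) k A =
    row_sum (Suc m) k (slot_sum k (Suc (Suc m)) A) -
    row_sum m k (\<lambda>x. A (x(Suc m := v, Suc (Suc m) := v)))"
proof -
  let ?M = "Suc m"
  let ?g = "\<lambda>(l, v). weight (Suc ?M) k (l(Suc ?M := v)) * A (\<lambda>i. of_int ((l(Suc ?M := v)) i))"
  let ?X = "interlacing ?M k \<times> {k (Suc ?M)..k (Suc (Suc ?M))}"
  let ?Y = "{(l, v) \<in> ?X. ?M = 0 \<or> l ?M < v}"
  let ?w = "k (Suc ?M)"
  \<comment> \<open>A pair \<open>(l, u)\<close> in \<open>?X - ?Y\<close> satisfies
    \<open>?w \<le> u \<le> l ?M \<le> ?w\<close>, so both last entries equal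
    \<open>?w\<close>.\<close>
  have "sum ?g (?X - ?Y) = row_sum m k (\<lambda>x. A (x(?M := v, Suc ?M := v)))"
    unfolding row_sum_def
  proof (rule sum.reindex_bij_witness
      [where j = "\<lambda>(l, _). l(?M := 0)" and i = "\<lambda>l. (l(?M := ?w), ?w)"], goal_cases)
    case (1 p)
    then obtain l u where p: "p = (l, u)" "l \<in> interlacing ?M k" "u \<ge> ?w" "u \<le> l ?M"
      by (cases p) auto
    moreover have "l ?M \<le> ?w" using p(2) by (auto simp: interlacing_def)
    ultimately show ?case by (auto simp: fun_eq_iff)
  next
    case (2 p)
    then show ?case using interlacing_cut by auto
  next
    case (3 l)
    then show ?case by (auto simp: interlacing_def fun_eq_iff)
  next
    case (4 l)
    \<comment> \<open>Strictness of \<open>k\<close> is what lets a doubled \<open>?w\<close> be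
      appended to every shorter row.\<close>
    have "l m < ?w" if "m > 0"
    proof -
      have "l m \<le> k (Suc m)" using 4 that by (auto simp: interlacing_def)
      with k[of "Suc m"] show ?thesis by simp
    qed
    moreover have "k (Suc m) < ?w" "?w < k (Suc (Suc (Suc m)))" using k by auto
    ultimately show ?case
      using 4 by (auto simp: interlacing_def le_Suc_eq less_Suc_eq)
  next
    case (5 p)
    then obtain l u where p: "p = (l, u)" "l \<in> interlacing ?M k" "u \<ge> ?w" "u \<le> l ?M"
      by (cases p) auto
    moreover have "l ?M \<le> ?w" using p(2) by (auto simp: interlacing_def)
    ultimately have u: "u = ?w" "l ?M = ?w" by auto
    have l: "l = (l(?M := 0))(?M := ?w)" using u by auto
    have "weight (Suc ?M) k (l(Suc ?M := u)) = weight m k (l(?M := 0))"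
      using u by (subst l) (simp only: weight_Suc_upd, simp)
    moreover have "(\<lambda>i. rat_of_int ((l(Suc ?M := u)) i)) =
        (\<lambda>i. of_int ((l(?M := 0)) i))(?M := v, Suc ?M := v)"
      using u by (auto simp: v_def)
    ultimately show ?case using p(1) by (simp only: prod.case)
  qed
  moreover have "sum ?g ?X = sum ?g (?X - ?Y) + sum ?g ?Y"
    by (rule sum.subset_diff) auto
  ultimately show ?thesis
    unfolding row_sum_Suc[of ?M] row_sum_slot_sum by simp
qed

subsection \<open>Telescoping of the row sums\<close>

text \<open>The telescoped sum over slot \<open>i\<close> contributes its left endpoint if \<open>i < r\<close> and its right
  endpoint otherwise, so that slots \<open>1, \<dots>, m\<close> use all of \<open>k 1, \<dots>, k (m + 1)\<close> but \<open>k r\<close>.\<close>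

definition corner :: "nat \<Rightarrow> nat \<Rightarrow> fn \<Rightarrow> fn" where
  "corner r i f = (\<lambda>x. if i < r then (1 - Q) * shift i f x - f x else shift i f x - (1 - Q) * f x)"

primrec corners :: "nat \<Rightarrow> nat \<Rightarrow> fn \<Rightarrow> fn" where
  "corners r 0 f = f"
| "corners r (Suc m) f = corners r m (corner r (Suc m) f)"

definition skip :: "nat \<Rightarrow> nat \<Rightarrow> nat" where
  "skip r i = (if i < r then i else Suc i)"

definition corner_term :: "(nat \<Rightarrow> int) \<Rightarrow> nat \<Rightarrow> nat \<Rightarrow> fn \<Rightarrow> rat poly" where
  "corner_term k r m f = corners r m f (\<lambda>i. if i \<in> {1..m} then of_int (k (skip r i)) else 0)"

lemma corner_upd_same:
  "corner r i f (x(i := v)) =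
     (if i < r then (1 - Q) * f (x(i := v + 1)) - f (x(i := v))
      else f (x(i := v + 1)) - (1 - Q) * f (x(i := v)))"
  by (simp add: corner_def shift_def)

lemma corner_upd:
  "j \<noteq> i \<Longrightarrow> corner r i (\<lambda>y. f (y(j := v))) = (\<lambda>x. corner r i f (x(j := v)))"
  by (auto simp: corner_def shift_def fun_eq_iff fun_upd_twist)

lemma corner_add: "corner r i (\<lambda>x. f x + g x) = (\<lambda>x. corner r i f x + corner r i g x)"
  by (auto simp: corner_def shift_def fun_eq_iff algebra_simps)

lemma corners_upd:
  "m < j \<Longrightarrow> corners r m (\<lambda>y. f (y(j := v))) = (\<lambda>x. corners r m f (x(j := v)))"
  by (induction m arbitrary: f) (auto simp: corner_upd)

lemma corners_add: "corners r m (\<lambda>x. f x + g x) = (\<lambda>x. corners r m f x + corners r m g x)"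
  by (induction m arbitrary: f g) (auto simp: corner_add)

lemma corners_cong: "m < r \<Longrightarrow> m < r' \<Longrightarrow> corners r m f = corners r' m f"
  by (induction m arbitrary: f) (auto simp: corner_def)

lemma corner_term_add:
  "corner_term k r m (\<lambda>x. f x + g x) = corner_term k r m f + corner_term k r m g"
  by (simp add: corner_term_def corners_add)

text \<open>With \<open>m < r\<close> every slot takes its left endpoint, whatever \<open>r\<close>
  is.\<close>

lemma corner_term_cong:
  assumes "m < r" "m < r'"
  shows "corner_term k r m f = corner_term k r' m f"
proof -
  have "(\<lambda>i. if i \<in> {1..m} then rat_of_int (k (skip r i)) else 0) =
        (\<lambda>i. if i \<in> {1..m} then of_int (k (skip r' i)) else 0)"
    using assms by (auto simp: skip_def)
  then show ?thesis
    using corners_cong[OF assms] by (simp add: corner_term_def)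
qed

lemma corner_term_Suc:
  "corner_term k r (Suc m) f =
     corner_term k r m (\<lambda>x. corner r (Suc m) f (x(Suc m := of_int (k (skip r (Suc m))))))"
proof -
  have "(\<lambda>i. if i \<in> {1..Suc m} then rat_of_int (k (skip r i)) else 0) =
    (\<lambda>i. if i \<in> {1..m} then of_int (k (skip r i)) else 0)(Suc m := of_int (k (skip r (Suc m))))"
    by (auto simp: fun_eq_iff)
  then show ?thesis
    by (simp add: corner_term_def corners_upd)
qed

text \<open>Any index beyond the slot selects the left branch of \<open>corner\<close>. Fixing it as
  \<open>Suc (Suc m)\<close>, and as \<open>0\<close> in \<open>corner_term_right\<close>, makes the
  inner function the same for all \<open>r\<close> in question.\<close>

lemma corner_term_left:
  "Suc m < r \<Longrightarrow> corner_term k r (Suc m) f =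
     corner_term k r m (\<lambda>x. corner (Suc (Suc m)) (Suc m) f (x(Suc m := of_int (k (Suc m)))))"
  by (simp add: corner_term_Suc skip_def corner_def)

lemma corner_term_right:
  "r \<le> Suc m \<Longrightarrow> corner_term k r (Suc m) f =
     corner_term k r m (\<lambda>x. corner 0 (Suc m) f (x(Suc m := of_int (k (Suc (Suc m))))))"
  by (simp add: corner_term_Suc skip_def corner_def)

lemma sum_int_telescope:
  fixes g :: "int \<Rightarrow> 'a :: ab_group_add"
  assumes "a \<le> b"
  shows "(\<Sum>v\<in>{a..<b}. g (v + 1) - g v) = g b - g a"
  using assms
proof (induction b rule: int_ge_induct)
  case (step b)
  have "{a..<b + 1} = insert b {a..<b}" using step by auto
  then show ?case using step by simp
qed simp

text \<open>The interior, of weight \<open>Q\<close>, telescopes to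
  \<open>Q * (g b - g (a + 1))\<close>; adding the two end terms of weight 1 produces the
  coefficients \<open>1 - Q\<close>.\<close>

lemma weighted_telescope:
  fixes g :: "int \<Rightarrow> rat poly"
  assumes "a < b"
  shows "(\<Sum>v\<in>{a..b}. (if a < v \<and> v < b then Q else 1) * (g (v + 1) - g v)) =
    ((1 - Q) * g (a + 1) - g a) + (g (b + 1) - (1 - Q) * g b)"
proof -
  have "{a..b} = insert a (insert b {a + 1..<b})" using assms by auto
  then have "(\<Sum>v\<in>{a..b}. (if a < v \<and> v < b then Q else 1) * (g (v + 1) - g v)) =
      (g (a + 1) - g a) + ((g (b + 1) - g b) + (\<Sum>v\<in>{a + 1..<b}. Q * (g (v + 1) - g v)))"
    using assms by simp
  also have "(\<Sum>v\<in>{a + 1..<b}. Q * (g (v + 1) - g v)) = Q * (g b - g (a + 1))"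
    using assms by (simp only: sum_distrib_left[symmetric] sum_int_telescope zless_imp_add1_zle)
  finally show ?thesis by (simp only: algebra_simps)
qed

lemma slot_sum_diff:
  assumes "k m < k (Suc m)"
  shows "slot_sum k m (diff m f) =
    (\<lambda>x. corner (Suc m) m f (x(m := of_int (k m))) + corner 0 m f (x(m := of_int (k (Suc m)))))"
proof
  fix x
  have "slot_sum k m (diff m f) x = (\<Sum>v\<in>{k m..k (Suc m)}.
      (if k m < v \<and> v < k (Suc m) then Q else 1) *
      (f (x(m := of_int (v + 1))) - f (x(m := of_int v))))"
    by (simp add: slot_sum_def diff_def shift_def)
  also have "\<dots> = corner (Suc m) m f (x(m := of_int (k m))) +
      corner 0 m f (x(m := of_int (k (Suc m))))"
    by (subst weighted_telescope[OF assms]) (simp add: corner_upd_same)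
  finally show "slot_sum k m (diff m f) x = \<dots>" .
qed

lemma slot_sum_differences:
  assumes "k (Suc m) < k (Suc (Suc m))"
  shows "slot_sum k (Suc m) (differences (Suc m) f) =
    differences m (\<lambda>x. corner (Suc (Suc m)) (Suc m) f (x(Suc m := of_int (k (Suc m)))) +
      corner 0 (Suc m) f (x(Suc m := of_int (k (Suc (Suc m))))))"
proof -
  have "slot_sum k (Suc m) (differences m (diff (Suc m) f)) =
      differences m (slot_sum k (Suc m) (diff (Suc m) f))"
    by (rule differences_commute) (simp add: slot_sum_def diff_sum diff_upd)
  then show ?thesis using slot_sum_diff[of k "Suc m", OF assms] by simp
qed

text \<open>What the cancellation needs: if \<open>factor_op (Suc i) i f\<close> is antisymmetric in
  the variables \<open>i\<close> and \<open>Suc i\<close>, then it vanishes where they are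
  equal.\<close>

definition shift_antisym :: "nat \<Rightarrow> fn \<Rightarrow> bool" where
  "shift_antisym m f \<longleftrightarrow>
     (\<forall>i x. 1 \<le> i \<longrightarrow> i < m \<longrightarrow> x i = x (Suc i) \<longrightarrow> factor_op (Suc i) i f x = 0)"

lemma shift_antisym_add:
  "shift_antisym m f \<Longrightarrow> shift_antisym m g \<Longrightarrow> shift_antisym m (\<lambda>x. f x + g x)"
proof -
  have "factor_op s t (\<lambda>x. f x + g x) = (\<lambda>x. factor_op s t f x + factor_op s t g x)" for s t
    by (simp add: factor_op_def shift_def fun_eq_iff algebra_simps)
  then show "shift_antisym m f \<Longrightarrow> shift_antisym m g \<Longrightarrow> shift_antisym m (\<lambda>x. f x + g x)"
    by (simp add: shift_antisym_def)
qed

text \<open>\<open>corner\<close> followed by fixing variable \<open>Suc m\<close> is a combination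
  of two restrictions of \<open>f\<close>, and \<open>factor_op (Suc i) i\<close> with
  \<open>i < m\<close> does not touch that variable.\<close>

lemma shift_antisym_corner:
  assumes "shift_antisym (Suc m) f"
  shows "shift_antisym m (\<lambda>x. corner r (Suc m) f (x(Suc m := v)))"
  unfolding shift_antisym_def
proof (intro allI impI)
  fix i and x :: "nat \<Rightarrow> rat"
  assume i: "1 \<le> i" "i < m" "x i = x (Suc i)"
  have "factor_op (Suc i) i (\<lambda>x. a * f (x(Suc m := u)) - b * f (x(Suc m := w))) x =
     a * factor_op (Suc i) i (\<lambda>x. f (x(Suc m := u))) x -
     b * factor_op (Suc i) i (\<lambda>x. f (x(Suc m := w))) x" for a b u w
    by (simp add: factor_op_def shift_def algebra_simps)
  moreover have "factor_op (Suc i) i (\<lambda>x. f (x(Suc m := u))) x = 0" for u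
    using assms i by (simp add: factor_op_upd shift_antisym_def)
  ultimately have *: "factor_op (Suc i) i (\<lambda>x. a * f (x(Suc m := u)) - b * f (x(Suc m := w))) x = 0"
    for a b u w by simp
  show "factor_op (Suc i) i (\<lambda>x. corner r (Suc m) f (x(Suc m := v))) x = 0"
    using *[of "1 - Q" "v + 1" 1 v] *[of 1 "v + 1" "1 - Q" v]
    by (cases "Suc m < r") (simp_all only: corner_upd_same if_True if_False mult_1_left)
qed

text \<open>\<open>d\<close>, \<open>a\<close>, \<open>b\<close>, \<open>c\<close> stand for the
  values of \<open>f\<close> at \<open>(v, v)\<close>, \<open>(v, v + 1)\<close>,
  \<open>(v + 1, v)\<close>, \<open>(v + 1, v + 1)\<close> in two adjacent slots. From the double
  difference the term with right endpoint in the first and left endpoint in the second slot is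
  subtracted; what remains is \<open>q\<close> times the operator of
  \<open>shift_antisym\<close>.\<close>

lemma corner_identity:
  fixes a b c d q :: "'a :: comm_ring_1"
  shows "(c - b - a + d) - (((1 - q) * c - b) - (1 - q) * ((1 - q) * a - d)) =
    q * (d - (2 - q) * a + c)"
  by (simp add: algebra_simps)

text \<open>Induction by splitting off the last slot, whose endpoints give \<open>fL\<close> and
  \<open>fR\<close>. The rows with equal last entries, which have to be subtracted, cancel exactly
  the terms in which \<open>fL\<close> is preceded by a right endpoint.\<close>

lemma row_sum_differences:
  assumes "\<And>i. 1 \<le> i \<Longrightarrow> i \<le> m \<Longrightarrow> k i < k (Suc i)" "shift_antisym m f"
  shows "row_sum m k (differences m f) = (\<Sum>r\<in>{1..Suc m}. corner_term k r m f)"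
  using assms
proof (induction m arbitrary: f rule: less_induct)
  case (less m)
  consider "m = 0" | "m = 1" | n where "m = Suc (Suc n)"
    by (metis One_nat_def not0_implies_Suc)
  then show ?case
  proof cases
    case 1
    then show ?thesis
      by (simp add: row_sum_def interlacing_0 weight_def corner_term_def)
  next
    case 2
    have "row_sum 1 k (differences 1 f) = row_sum 0 k (slot_sum k (Suc 0) (differences (Suc 0) f))"
      by (simp add: row_sum_1)
    also have "\<dots> = row_sum 0 k (\<lambda>x. corner 2 1 f (x(1 := of_int (k 1))) +
        corner 0 1 f (x(1 := of_int (k 2))))"
      using less.prems(1)[of 1] 2 by (subst slot_sum_differences) (simp_all add: numeral_2_eq_2)
    also have "\<dots> = corner_term k 2 1 f + corner_term k 1 1 f"
      by (simp add: row_sum_def interlacing_0 weight_def corner_term_Suc skip_def corner_def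
          corner_term_def[of _ _ 0] numeral_2_eq_2)
    finally show ?thesis using 2 by (simp add: numeral_2_eq_2)
  next
    case (3 n)
    define M where "M = Suc (Suc n)"
    define v where "v = rat_of_int (k M)"
    define fL where "fL = (\<lambda>x. corner (Suc M) M f (x(M := v)))"
    define fR where "fR = (\<lambda>x. corner 0 M f (x(M := of_int (k (Suc M)))))"
    define fRL where "fRL = (\<lambda>x. corner 0 (Suc n) fL (x(Suc n := v)))"
    have k: "\<And>i. 1 \<le> i \<Longrightarrow> i \<le> M \<Longrightarrow> k i < k (Suc i)"
      using less.prems(1) 3 by (simp add: M_def)
    have f: "shift_antisym M f"
      using less.prems(2) 3 by (simp add: M_def)
    have fL: "shift_antisym (Suc n) fL" and fR: "shift_antisym (Suc n) fR"
      using f unfolding fL_def fR_def M_def by (rule shift_antisym_corner)+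
    have fRL: "shift_antisym n fRL"
      using fL unfolding fRL_def by (rule shift_antisym_corner)

    \<comment> \<open>The differences in the variables \<open>1, ..., n\<close> commute with the
      substitution, leaving the double difference in the last two variables.\<close>
    have "(\<lambda>x. differences M f (x(Suc n := v, M := v))) =
        differences n (\<lambda>x. diff (Suc n) (diff M f) (x(Suc n := v, M := v)))"
      unfolding M_def differences.simps
      by (rule differences_commute[where T = "\<lambda>f x. f (x(Suc n := v, Suc (Suc n) := v))"])
        (subst diff_upd[where j = "Suc n"], simp,
         subst diff_upd[where j = "Suc (Suc n)"], simp_all)
    also have "(\<lambda>x. diff (Suc n) (diff M f) (x(Suc n := v, M := v))) = fRL"
    proof
      fix x :: "nat \<Rightarrow> rat"
      define F where "F a b = f (x(Suc n := a, M := b))" for a b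
      define y where "y = x(Suc n := v, M := v)"
      have vanish: "factor_op M (Suc n) f y = 0"
        using f unfolding shift_antisym_def M_def y_def by auto
      have "factor_op M (Suc n) f y = F v v - (2 - Q) * F v (v + 1) + F (v + 1) (v + 1)"
        by (simp add: factor_op_def shift_def F_def y_def M_def fun_upd_twist)
      moreover have "diff (Suc n) (diff M f) y =
          F (v + 1) (v + 1) - F (v + 1) v - F v (v + 1) + F v v"
        by (simp add: diff_def shift_def F_def y_def M_def fun_upd_twist)
      moreover have "fRL x = ((1 - Q) * F (v + 1) (v + 1) - F (v + 1) v) -
          (1 - Q) * ((1 - Q) * F v (v + 1) - F v v)"
        unfolding fRL_def fL_def corner_upd_same by (simp add: F_def M_def)
      ultimately have "diff (Suc n) (diff M f) y - fRL x = Q * factor_op M (Suc n) f y"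
        by (simp only: corner_identity)
      with vanish show "diff (Suc n) (diff M f) (x(Suc n := v, M := v)) = fRL x"
        by (simp add: y_def)
    qed
    finally have "row_sum n k (\<lambda>x. differences M f (x(Suc n := v, M := v))) = row_sum n k (differences n fRL)"
      by (simp only:)
    also have "\<dots> = (\<Sum>r\<in>{1..Suc n}. corner_term k r n fRL)"
      using less.IH[of n fRL] 3 fRL k by (simp add: M_def)
    also have "\<dots> = (\<Sum>r\<in>{1..Suc n}. corner_term k r (Suc n) fL)"
      by (rule sum.cong) (simp_all add: corner_term_right fRL_def v_def M_def)
    finally have coincide: "row_sum n k (\<lambda>x. differences M f (x(Suc n := v, M := v))) =
      (\<Sum>r\<in>{1..Suc n}. corner_term k r (Suc n) fL)" .

    have "row_sum (Suc n) k (slot_sum k M (differences M f)) =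
        row_sum (Suc n) k (differences (Suc n) (\<lambda>x. fL x + fR x))"
      unfolding M_def fL_def fR_def v_def by (subst slot_sum_differences) (use k M_def in auto)
    also have "\<dots> = (\<Sum>r\<in>{1..M}. corner_term k r (Suc n) (\<lambda>x. fL x + fR x))"
      using less.IH[of "Suc n" "\<lambda>x. fL x + fR x"] 3 shift_antisym_add[OF fL fR] k
      by (simp add: M_def)
    also have "\<dots> = (\<Sum>r\<in>{1..M}. corner_term k r (Suc n) fL) + (\<Sum>r\<in>{1..M}. corner_term k r (Suc n) fR)"
      by (simp add: corner_term_add sum.distrib)
    \<comment> \<open>The sum up to \<open>Suc n\<close> is the one in \<open>coincide\<close>. For
      \<open>r = M\<close> all slots take left endpoints, so \<open>r\<close> can be raised to
      \<open>Suc M\<close>, where slot \<open>M\<close> does so too.\<close>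
    also have "(\<Sum>r\<in>{1..M}. corner_term k r (Suc n) fL) =
        (\<Sum>r\<in>{1..Suc n}. corner_term k r (Suc n) fL) + corner_term k (Suc M) (Suc n) fL"
      using corner_term_cong[of "Suc n" M "Suc M"] by (simp add: M_def)
    also have "corner_term k (Suc M) (Suc n) fL = corner_term k (Suc M) M f"
      by (simp add: M_def corner_term_left fL_def v_def)
    also have "(\<Sum>r\<in>{1..M}. corner_term k r (Suc n) fR) = (\<Sum>r\<in>{1..M}. corner_term k r M f)"
      unfolding M_def
      by (rule sum.cong) (simp_all add: corner_term_right fR_def M_def)
    finally have "row_sum (Suc n) k (slot_sum k M (differences M f)) =
        row_sum n k (\<lambda>x. differences M f (x(Suc n := v, M := v))) +
        (\<Sum>r\<in>{1..Suc M}. corner_term k r M f)"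
      using coincide by simp
    then show ?thesis
      using row_sum_Suc_Suc[of n k "differences M f"] k 3 unfolding M_def v_def by simp
  qed
qed

subsection \<open>Removing the bottom row of a monotone triangle\<close>

text \<open>Row 0 is cleared since it would otherwise hold row 1 of \<open>T\<close>; in column 0 a
  triangle supplies the zeros itself.\<close>

definition upper_rows :: "(nat \<Rightarrow> nat \<Rightarrow> int) \<Rightarrow> nat \<Rightarrow> nat \<Rightarrow> int" where
  "upper_rows T = (\<lambda>i j. if i = 0 then 0 else T (Suc i) (Suc j))"

definition add_row :: "(nat \<Rightarrow> int) \<Rightarrow> (nat \<Rightarrow> nat \<Rightarrow> int) \<Rightarrow> nat \<Rightarrow> nat \<Rightarrow> int" where
  "add_row k T = (\<lambda>i j. if i = 1 then k j else if i = 0 \<or> j = 0 then 0 else T (i - 1) (j - 1))"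

lemma monotone_triangleD:
  assumes "monotone_triangle n a"
  shows "1 \<le> i \<Longrightarrow> i \<le> j \<Longrightarrow> j < n \<Longrightarrow> a i j \<le> a (Suc i) (Suc j)"
    and "1 \<le> i \<Longrightarrow> Suc i \<le> j \<Longrightarrow> j \<le> n \<Longrightarrow> a (Suc i) j \<le> a i j"
    and "1 \<le> i \<Longrightarrow> i \<le> j \<Longrightarrow> j < n \<Longrightarrow> a i j < a i (Suc j)"
    and "\<not> (1 \<le> i \<and> i \<le> j \<and> j \<le> n) \<Longrightarrow> a i j = 0"
proof -
  note a = assms[unfolded monotone_triangle_def]
  show "1 \<le> i \<Longrightarrow> i \<le> j \<Longrightarrow> j < n \<Longrightarrow> a i j \<le> a (Suc i) (Suc j)"
    using a by auto
  show "a (Suc i) j \<le> a i j" if "1 \<le> i" "Suc i \<le> j" "j \<le> n"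
  proof -
    from a have "\<forall>i j. 1 < i \<and> i \<le> j \<and> j \<le> n \<longrightarrow> a i j \<le> a (i - 1) j" by blast
    from this[rule_format, of "Suc i" j] that show ?thesis by simp
  qed
  show "1 \<le> i \<Longrightarrow> i \<le> j \<Longrightarrow> j < n \<Longrightarrow> a i j < a i (Suc j)"
    using a by auto
  show "\<not> (1 \<le> i \<and> i \<le> j \<and> j \<le> n) \<Longrightarrow> a i j = 0"
    using a by blast
qed

lemma upper_rows_in:
  assumes "T \<in> monotone_triangles (Suc n) k"
  shows "upper_rows T \<in> monotone_triangles n (upper_rows T 1)"
    and "upper_rows T 1 \<in> interlacing n k"
proof -
  have T: "monotone_triangle (Suc n) T" and k: "\<And>j. 1 \<le> j \<Longrightarrow> j \<le> Suc n \<Longrightarrow> T 1 j = k j"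
    using assms by (auto simp: monotone_triangles_def)
  have "upper_rows T i j \<le> upper_rows T (i - 1) j" if "1 < i" "i \<le> j" "j \<le> n" for i j
    using that monotone_triangleD(2)[OF T, of i "Suc j"] by (auto simp: upper_rows_def)
  then show "upper_rows T \<in> monotone_triangles n (upper_rows T 1)"
    using monotone_triangleD(1,3,4)[OF T]
    by (auto simp: monotone_triangles_def monotone_triangle_def upper_rows_def)
  have "k i \<le> T 2 (Suc i) \<and> T 2 (Suc i) \<le> k (Suc i)" if "1 \<le> i" "i \<le> n" for i
    using that monotone_triangleD(1)[OF T, of 1 i] monotone_triangleD(2)[OF T, of 1 "Suc i"] k
    by (simp add: numeral_2_eq_2)
  moreover have "T 2 (Suc i) < T 2 (Suc (Suc i))" if "1 \<le> i" "i < n" for i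
    using that monotone_triangleD(3)[OF T, of 2 "Suc i"] by simp
  moreover have "T 2 (Suc i) = 0" if "i \<notin> {1..n}" for i
    using that monotone_triangleD(4)[OF T, of 2 "Suc i"] by auto
  ultimately show "upper_rows T 1 \<in> interlacing n k"
    by (auto simp: interlacing_def upper_rows_def numeral_2_eq_2)
qed

lemma add_row_in:
  assumes k: "\<And>i. 1 \<le> i \<Longrightarrow> i \<le> n \<Longrightarrow> k i < k (Suc i)" "\<And>i. i \<notin> {1..Suc n} \<Longrightarrow> k i = 0"
    and l: "l \<in> interlacing n k" and T: "T \<in> monotone_triangles n l"
  shows "add_row k T \<in> monotone_triangles (Suc n) k"
proof -
  have T': "monotone_triangle n T" and T1: "\<And>j. 1 \<le> j \<Longrightarrow> j \<le> n \<Longrightarrow> T 1 j = l j"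
    using T by (auto simp: monotone_triangles_def)
  have l': "k i \<le> l i" "l i \<le> k (Suc i)" if "1 \<le> i" "i \<le> n" for i
    using l that by (auto simp: interlacing_def)
  have "monotone_triangle (Suc n) (add_row k T)"
    unfolding monotone_triangle_def
  proof (intro conjI allI impI, goal_cases)
    case (1 i j)
    then show ?case
      using monotone_triangleD(1)[OF T', of "i - 1" "j - 1"] T1[of j] l'(1)[of j]
      by (cases "i = 1") (auto simp: add_row_def)
  next
    case (2 i j)
    then show ?case
      using monotone_triangleD(2)[OF T', of "i - 2" "j - 1"] T1[of "j - 1"] l'(2)[of "j - 1"]
      by (cases "i = 2") (auto simp: add_row_def numeral_2_eq_2 Suc_diff_Suc)
  next
    case (3 i j)
    then show ?case
      using monotone_triangleD(3)[OF T', of "i - 1" "j - 1"] k(1)[of j]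
      by (cases "i = 1") (auto simp: add_row_def)
  next
    case (4 i j)
    then have "i \<le> 1 \<or> j = 0 \<or> \<not> (1 \<le> i - 1 \<and> i - 1 \<le> j - 1 \<and> j - 1 \<le> n)"
      by auto
    then show ?case
      using 4 monotone_triangleD(4)[OF T', of "i - 1" "j - 1"] k(2)[of j]
      by (cases "i = 1") (auto simp: add_row_def)
  qed
  then show ?thesis by (auto simp: monotone_triangles_def add_row_def)
qed

text \<open>Inversions in row 2 compare \<open>upper_rows T 1\<close> with \<open>k\<close> and are
  recorded by \<open>weight\<close>; those in higher rows are the inversions of
  \<open>upper_rows T\<close>, moved by one in both indices.\<close>

lemma triangle_inv_Suc:
  assumes "T \<in> monotone_triangles (Suc n) k"
  shows "Q ^ triangle_inv (Suc n) T =
    weight n k (upper_rows T 1) * Q ^ triangle_inv n (upper_rows T)"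
proof -
  let ?I = "\<lambda>n T. {(i, j). 1 < i \<and> i \<le> j \<and> j \<le> n \<and>
    T (i - 1) (j - 1) < T i j \<and> T i j < T (i - 1) (j :: nat)}"
  let ?l = "upper_rows T 1"
  let ?J = "{i \<in> {1..n}. k i < ?l i \<and> ?l i < k (Suc i)}"
  have k: "\<And>j. 1 \<le> j \<Longrightarrow> j \<le> Suc n \<Longrightarrow> T 1 j = k j"
    using assms by (auto simp: monotone_triangles_def)
  have fin: "finite (?I n T)" for n and T :: "nat \<Rightarrow> nat \<Rightarrow> int"
    by (rule finite_subset[of _ "{..n} \<times> {..n}"]) auto
  have "?I (Suc n) T = (\<lambda>j. (2, Suc j)) ` ?J \<union> map_prod Suc Suc ` ?I n (upper_rows T)" (is "?L = ?R")
  proof (rule Set.set_eqI)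
    fix p :: "nat \<times> nat"
    obtain i j where p: "p = (i, j)" by (cases p)
    show "p \<in> ?L \<longleftrightarrow> p \<in> ?R"
    proof (cases "i = 2")
      case True
      then show ?thesis
        using p k[of j] k[of "j - 1"]
        by (cases j) (auto simp: upper_rows_def numeral_2_eq_2)
    next
      case False
      then show ?thesis
        using p by (cases i; cases j; cases "i - 1") (auto simp: upper_rows_def)
    qed
  qed
  moreover have "card ((\<lambda>j. (2 :: nat, Suc j)) ` ?J \<union> map_prod Suc Suc ` ?I n (upper_rows T)) =
      card ?J + card (?I n (upper_rows T))"
    by (subst card_Un_disjoint) (use fin in \<open>auto simp: card_image inj_on_def\<close>)
  ultimately have "triangle_inv (Suc n) T = card ?J + triangle_inv n (upper_rows T)"
    by (simp add: triangle_inv_def)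
  moreover have "weight n k ?l = Q ^ card ?J"
    unfolding weight_def by (subst prod.inter_filter[symmetric]) simp_all
  ultimately show ?thesis by (simp add: power_add)
qed

lemma sum_monotone_triangles_Suc:
  assumes "n \<ge> 1"
    and k: "\<And>i. 1 \<le> i \<Longrightarrow> i \<le> n \<Longrightarrow> k i < k (Suc i)" "\<And>i. i \<notin> {1..Suc n} \<Longrightarrow> k i = 0"
  shows "(\<Sum>T\<in>monotone_triangles (Suc n) k. Q ^ triangle_inv (Suc n) T) =
    (\<Sum>l\<in>interlacing n k. weight n k l * (\<Sum>T\<in>monotone_triangles n l. Q ^ triangle_inv n T))"
proof -
  have "(\<Sum>T\<in>monotone_triangles (Suc n) k. Q ^ triangle_inv (Suc n) T) =
    (\<Sum>(l, T)\<in>Sigma (interlacing n k) (monotone_triangles n). weight n k l * Q ^ triangle_inv n T)"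
  proof (rule sum.reindex_bij_witness
      [where j = "\<lambda>T. (upper_rows T 1, upper_rows T)" and i = "\<lambda>(_, T). add_row k T"], goal_cases)
    case (1 T)
    then have T: "monotone_triangle (Suc n) T" and T1: "\<And>j. 1 \<le> j \<Longrightarrow> j \<le> Suc n \<Longrightarrow> T 1 j = k j"
      by (auto simp: monotone_triangles_def)
    have "add_row k (upper_rows T) i j = T i j" for i j
      using monotone_triangleD(4)[OF T, of i j] T1[of j] k(2)[of j]
      by (cases "j \<le> Suc n") (auto simp: add_row_def upper_rows_def)
    then show ?case by (simp add: fun_eq_iff)
  next
    case (2 T)
    then show ?case using upper_rows_in by simp
  next
    case (3 p)
    then obtain l T where p: "p = (l, T)" "l \<in> interlacing n k" "T \<in> monotone_triangles n l"
      by auto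
    then have T: "monotone_triangle n T" and T1: "\<And>j. 1 \<le> j \<Longrightarrow> j \<le> n \<Longrightarrow> T 1 j = l j"
      by (auto simp: monotone_triangles_def)
    have "upper_rows (add_row k T) i j = T i j" for i j
      using monotone_triangleD(4)[OF T, of i j] by (auto simp: add_row_def upper_rows_def)
    then have "upper_rows (add_row k T) = T" by (simp add: fun_eq_iff)
    moreover have "T 1 j = l j" for j
      using monotone_triangleD(4)[OF T, of 1 j] T1[of j] p(2)
      by (cases "j \<in> {1..n}") (auto simp: interlacing_def)
    ultimately show ?case using p(1) by (auto simp: fun_eq_iff)
  next
    case (4 p)
    then show ?case using add_row_in[of n k, OF k] by auto
  next
    case (5 T)
    then show ?case by (simp add: triangle_inv_Suc)
  qed
  also have "\<dots> = (\<Sum>l\<in>interlacing n k. \<Sum>T\<in>monotone_triangles n l. weight n k l * Q ^ triangle_inv n T)"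
    by (rule sum.Sigma[symmetric]) (simp_all add: finite_monotone_triangles)
  finally show ?thesis by (simp add: sum_distrib_left)
qed

subsection \<open>Determinants of binomial coefficients\<close>

text \<open>Interpolates row by row between the determinant \<open>G\<close> at \<open>m = n\<close>
  and the determinant of the \<open>x i gchoose (j - 1)\<close> at \<open>m = 0\<close>. Matrix
  indices start at 0, variables at 1.\<close>

definition binom_det :: "nat \<Rightarrow> nat \<Rightarrow> (nat \<Rightarrow> rat) \<Rightarrow> rat" where
  "binom_det m n x = det (mat n n (\<lambda>(i, j). x (Suc i) gchoose (if i < m then Suc j else j)))"

text \<open>Expand along row \<open>m\<close>, the only one involving \<open>x (Suc m)\<close>, and
  apply Pascal's rule to its entries.\<close>

lemma binom_det_diff:
  assumes "m < n"
  shows "binom_det (Suc m) n (x(Suc m := x (Suc m) + 1)) - binom_det (Suc m) n x = binom_det m n x"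
proof -
  define A where "A p y = mat n n (\<lambda>(i, j). y (Suc i) gchoose (if i < p then Suc j else j))"
    for p and y :: "nat \<Rightarrow> rat"
  let ?y = "x(Suc m := x (Suc m) + 1)"
  \<comment> \<open>The four matrices differ only in row \<open>m\<close>, which is deleted.\<close>
  have cof: "cofactor (A p y) m j = cofactor (A m x) m j"
    if "p = m \<or> p = Suc m" "y = x \<or> y = ?y" for p y j
  proof -
    have "mat_delete (A p y) m j = mat_delete (A m x) m j"
      using that assms by (intro eq_matI) (auto simp: A_def mat_delete_def)
    then show ?thesis by (simp only: cofactor_def)
  qed
  have "binom_det p n y = (\<Sum>j<n. (y (Suc m) gchoose (if m < p then Suc j else j)) * cofactor (A m x) m j)"
    if "p = m \<or> p = Suc m" "y = x \<or> y = ?y" for p y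
  proof -
    have "binom_det p n y = det (A p y)" by (simp add: binom_det_def A_def)
    also have "\<dots> = (\<Sum>j<n. A p y $$ (m, j) * cofactor (A p y) m j)"
      by (rule laplace_expansion_row[OF _ assms]) (simp add: A_def)
    also have "\<dots> = (\<Sum>j<n. (y (Suc m) gchoose (if m < p then Suc j else j)) * cofactor (A m x) m j)"
      using assms cof[OF that] by (intro sum.cong) (auto simp: A_def)
    finally show ?thesis .
  qed
  from this[of "Suc m" ?y] this[of "Suc m" x] this[of m x] show ?thesis
    by (simp add: gbinomial_Suc_Suc sum_subtractf[symmetric] left_diff_distrib[symmetric])
qed

lemma differences_binom_det:
  "m \<le> n \<Longrightarrow> differences m (\<lambda>x. [:binom_det m n x:]) = (\<lambda>x. [:binom_det 0 n x:])"
proof (induction m)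
  case (Suc m)
  have "diff (Suc m) (\<lambda>x. [:binom_det (Suc m) n x:]) = (\<lambda>x. [:binom_det m n x:])"
    using binom_det_diff[of m n] Suc.prems by (simp add: diff_def shift_def)
  with Suc show ?case by simp
qed simp

lemma binom_det_transpose:
  assumes "1 \<le> i" "i < n"
  shows "binom_det n n (x \<circ> Transposition.transpose i (Suc i)) = - binom_det n n x"
proof -
  define A where "A = mat n n (\<lambda>(i, j). x (Suc i) gchoose Suc j)"
  have eq: "binom_det n n y = det (mat n n (\<lambda>(i, j). y (Suc i) gchoose Suc j))" for y
    unfolding binom_det_def by (rule arg_cong[of _ _ det]) auto
  have "mat n n (\<lambda>(i', j). (x \<circ> Transposition.transpose i (Suc i)) (Suc i') gchoose Suc j) =
      swaprows (i - 1) i A"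
    using assms by (intro eq_matI) (auto simp: A_def mat_swaprows_def Transposition.transpose_def)
  moreover have "det (swaprows (i - 1) i A) = - det A"
    using assms by (intro det_swaprows[of _ n]) (auto simp: A_def)
  ultimately show ?thesis unfolding eq A_def by simp
qed

text \<open>Expansion along the column of entries \<open>x i gchoose 0 = 1\<close>; the minors have
  the variables \<open>x \<circ> skip r\<close> and lower indices raised by one.\<close>

lemma binom_det_expand:
  "binom_det 0 (Suc n) x = (\<Sum>r\<in>{1..Suc n}. (- 1) ^ (r - 1) * binom_det n n (x \<circ> skip r))"
proof -
  define A where "A = mat (Suc n) (Suc n) (\<lambda>(i, j). x (Suc i) gchoose j)"
  have "binom_det 0 (Suc n) x = det A" by (simp add: binom_det_def A_def)
  also have "\<dots> = (\<Sum>i<Suc n. A $$ (i, 0) * cofactor A i 0)"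
    by (rule laplace_expansion_column) (auto simp: A_def)
  also have "\<dots> = (\<Sum>i<Suc n. (- 1) ^ i * binom_det n n (x \<circ> skip (Suc i)))"
  proof (rule sum.cong)
    fix i assume i: "i \<in> {..<Suc n}"
    have "mat_delete A i 0 =
        mat n n (\<lambda>(i', j). (x \<circ> skip (Suc i)) (Suc i') gchoose (if i' < n then Suc j else j))"
      using i by (intro eq_matI) (auto simp: A_def mat_delete_def skip_def)
    then show "A $$ (i, 0) * cofactor A i 0 = (- 1) ^ i * binom_det n n (x \<circ> skip (Suc i))"
      using i by (simp add: A_def cofactor_def binom_det_def)
  qed simp
  also have "\<dots> = (\<Sum>r\<in>{1..Suc n}. (- 1) ^ (r - 1) * binom_det n n (x \<circ> skip r))"
    by (rule sum.reindex_bij_witness[where i = "\<lambda>r. r - 1" and j = Suc]) auto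
  finally show ?thesis .
qed

section \<open>The determinant at \<open>m = 0\<close> as a Vandermonde product\<close>

definition gbinomial_poly :: "nat \<Rightarrow> rat poly" where
  "gbinomial_poly j = Polynomial.smult (1 / fact j) (\<Prod>i<j. [:- of_nat i, 1:])"

lemma poly_gbinomial_poly: "poly (gbinomial_poly j) x = x gchoose j"
  by (simp add: gbinomial_poly_def gbinomial_prod_rev poly_prod atLeast0LessThan)

lemma degree_prod_linear: "finite I \<Longrightarrow> degree (\<Prod>i\<in>I. [:- c i, 1 :: rat:]) = card I"
  by (subst degree_prod_eq_sum_degree) auto

lemma coeff_prod_linear:
  assumes "finite I"
  shows "poly.coeff (\<Prod>i\<in>I. [:- c i, 1 :: rat:]) (card I) = 1"
proof -
  have "lead_coeff (\<Prod>i\<in>I. [:- c i, 1 :: rat:]) = 1"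
    by (simp add: lead_coeff_prod)
  then show ?thesis by (simp only: degree_prod_linear[OF assms])
qed

lemma degree_gbinomial_poly: "degree (gbinomial_poly j) \<le> j"
  using degree_prod_linear[of "{..<j}" of_nat] by (simp add: gbinomial_poly_def)

lemma coeff_gbinomial_poly: "poly.coeff (gbinomial_poly j) j = 1 / fact j"
  using coeff_prod_linear[of "{..<j}" of_nat] by (simp add: gbinomial_poly_def)

text \<open>As a polynomial in the last variable, the determinant vanishes at all the other variables.\<close>

lemma binom_det_Suc:
  assumes "inj_on x {1..n}"
  shows "binom_det 0 (Suc n) x = binom_det 0 n x / fact n * (\<Prod>i\<in>{1..n}. x (Suc n) - x i)"
proof -
  define A where "A t = mat (Suc n) (Suc n) (\<lambda>(i, j). (x(Suc n := t)) (Suc i) gchoose j)" for t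
  define P where "P = (\<Sum>j<Suc n. Polynomial.smult (cofactor (A 0) n j) (gbinomial_poly j))"
  define R where "R = Polynomial.smult (binom_det 0 n x / fact n) (\<Prod>i\<in>{1..n}. [:- x i, 1:])"
  have A: "A t \<in> carrier_mat (Suc n) (Suc n)" for t by (simp add: A_def)
  \<comment> \<open>Only the deleted last row depends on \<open>t\<close>.\<close>
  have cof: "cofactor (A t) n j = cofactor (A 0) n j" for t j
  proof -
    have "mat_delete (A t) n j = mat_delete (A 0) n j"
      by (intro eq_matI) (auto simp: A_def mat_delete_def)
    then show ?thesis by (simp add: cofactor_def)
  qed
  have P: "poly P t = det (A t)" for t
  proof -
    have "det (A t) = (\<Sum>j<Suc n. A t $$ (n, j) * cofactor (A t) n j)"
      by (rule laplace_expansion_row[OF A]) simp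
    also have "\<dots> = (\<Sum>j<Suc n. cofactor (A 0) n j * (t gchoose j))"
      unfolding cof[of t] by (rule sum.cong) (auto simp: A_def)
    finally show ?thesis by (simp add: P_def poly_sum poly_gbinomial_poly)
  qed
  have "P = R"
  \<comment> \<open>Both have degree at most \<open>n\<close> and the same coefficient at
    \<open>n\<close>, so agreement at the \<open>n\<close> distinct points \<open>x i\<close>
    suffices.\<close>
  proof (rule poly_eqI_degree_lead_coeff[where n = n and A = "x ` {1..n}"])
    have "mat_delete (A 0) n n = mat n n (\<lambda>(i, j). x (Suc i) gchoose j)"
      by (intro eq_matI) (auto simp: A_def mat_delete_def)
    then have "cofactor (A 0) n n = binom_det 0 n x"
      by (simp add: cofactor_def binom_det_def)
    moreover have "poly.coeff (gbinomial_poly j) n = 0" if "j < n" for j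
      using that degree_gbinomial_poly[of j] by (intro coeff_eq_0) simp
    ultimately show "poly.coeff P n = poly.coeff R n"
      using coeff_prod_linear[of "{1..n}" x]
      by (simp add: P_def R_def coeff_sum coeff_gbinomial_poly)
    show "card (x ` {1..n}) \<ge> n"
      using assms by (simp add: card_image)
    show "degree P \<le> n" unfolding P_def
      by (rule degree_sum_le) (auto intro: order.trans[OF degree_smult_le] order.trans[OF degree_gbinomial_poly])
    show "degree R \<le> n"
      using degree_prod_linear[of "{1..n}" x] by (simp add: R_def)
    fix z assume "z \<in> x ` {1..n}"
    then obtain i where i: "1 \<le> i" "i \<le> n" "z = x i" by auto
    have "det (A z) = 0"
    proof (rule det_identical_rows[OF A, of "i - 1" n])
      show "row (A z) (i - 1) = row (A z) n"
        using i by (intro eq_vecI) (auto simp: A_def)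
    qed (use i in auto)
    then show "poly P z = poly R z"
      using i by (auto simp: P R_def poly_prod)
  qed
  have "binom_det 0 (Suc n) x = poly P (x (Suc n))"
    by (simp add: P A_def binom_det_def)
  also have "\<dots> = binom_det 0 n x / fact n * (\<Prod>i\<in>{1..n}. x (Suc n) - x i)"
    by (simp add: \<open>P = R\<close> R_def poly_prod)
  finally show ?thesis .
qed

lemma binom_det_not_inj:
  assumes "\<not> inj_on x {1..n}"
  shows "binom_det 0 n x = 0"
proof -
  obtain i j where ij: "i \<in> {1..n}" "j \<in> {1..n}" "i \<noteq> j" "x i = x j"
    using assms by (auto simp: inj_on_def)
  show ?thesis unfolding binom_det_def
  proof (rule det_identical_rows[of _ n "i - 1" "j - 1"])
    show "row (mat n n (\<lambda>(i, j). x (Suc i) gchoose (if i < 0 then Suc j else j))) (i - 1) =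
      row (mat n n (\<lambda>(i, j). x (Suc i) gchoose (if i < 0 then Suc j else j))) (j - 1)"
      using ij by (intro eq_vecI) auto
  qed (use ij in auto)
qed

text \<open>The last variable is added by \<open>binom_det_Suc\<close> when the earlier ones are
  distinct; otherwise both sides vanish.\<close>

lemma binom_det_vandermonde:
  "binom_det 0 n x = (\<Prod>(i, j)\<in>pairs n. (x j - x i) / (of_nat j - of_nat i))"
proof (induction n)
  case 0
  have "pairs 0 = {}" by (auto simp: pairs_def)
  then show ?case by (simp add: binom_det_def)
next
  case (Suc n)
  show ?case
  proof (cases "inj_on x {1..n}")
    case True
    have "pairs (Suc n) = pairs n \<union> (\<lambda>i. (i, Suc n)) ` {1..n}"
      by (auto simp: pairs_def le_Suc_eq)
    then have "(\<Prod>(i, j)\<in>pairs (Suc n). (x j - x i) / (of_nat j - of_nat i)) =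
        binom_det 0 n x * (\<Prod>(i, j)\<in>(\<lambda>i. (i, Suc n)) ` {1..n}. (x j - x i) / (of_nat j - of_nat i))"
      unfolding Suc.IH
      by (subst prod.union_disjoint[symmetric]) (simp, simp, auto simp: pairs_def[of n])
    also have "(\<Prod>(i, j)\<in>(\<lambda>i. (i, Suc n)) ` {1..n}. (x j - x i) / (of_nat j - of_nat i)) =
        (\<Prod>i\<in>{1..n}. (x (Suc n) - x i) / of_nat (Suc n - i))"
      by (subst prod.reindex) (auto simp: inj_on_def of_nat_diff intro!: prod.cong)
    also have "\<dots> = (\<Prod>i\<in>{1..n}. x (Suc n) - x i) / (\<Prod>i\<in>{1..n}. of_nat (Suc n - i))"
      by (rule prod_dividef)
    also have "(\<Prod>i\<in>{1..n}. of_nat (Suc n - i) :: rat) = (\<Prod>i\<in>{1..n}. of_nat i)"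
      by (rule prod.reindex_bij_witness[where i = "\<lambda>i. Suc n - i" and j = "\<lambda>i. Suc n - i"]) auto
    also have "\<dots> = fact n"
      by (simp add: fact_prod)
    finally show ?thesis using binom_det_Suc[OF True] by simp
  next
    case False
    then obtain i j where "i \<in> {1..n}" "j \<in> {1..n}" "i < j" "x i = x j"
      unfolding inj_on_def by (metis linorder_neq_iff)
    then have "(i, j) \<in> pairs (Suc n)" "(x j - x i) / (of_nat j - of_nat i) = 0"
      by (auto simp: pairs_def)
    then have "(\<Prod>(i, j)\<in>pairs (Suc n). (x j - x i) / (of_nat j - of_nat i)) = 0"
      by (intro prod_zero finite_pairs) (auto intro!: bexI[of _ "(i, j)"])
    moreover have "\<not> inj_on x {1..Suc n}"
      using False inj_on_subset[of x "{1..Suc n}" "{1..n}"] by auto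
    ultimately show ?thesis using binom_det_not_inj by simp
  qed
qed

lemma vandermonde_poly_eq: "vandermonde_poly n = (\<lambda>x. [:binom_det 0 n x:])"
  by (simp add: vandermonde_poly_def binom_det_vandermonde pairs_def fun_eq_iff)

subsection \<open>The operator formula\<close>

lemma ops_scale: "finite P \<Longrightarrow> ops P (\<lambda>x. c * f x) = (\<lambda>x. c * ops P f x)"
  using ops_sum[of P "\<lambda>_. c" "\<lambda>_. f" "{()}"] by simp

text \<open>Exchanging the variables \<open>i\<close> and \<open>Suc i\<close> permutes the pair set
  \<open>R\<close> and changes the sign of the determinant. At a point fixed by the exchange the
  value thus equals its own negative.\<close>

lemma shift_antisym_ops_binom_det:
  "shift_antisym n (ops (pairs n) (\<lambda>x. [:binom_det n n x:]))"
  unfolding shift_antisym_def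
proof (intro allI impI)
  fix i and x :: "nat \<Rightarrow> rat"
  assume i: "1 \<le> i" "i < n" "x i = x (Suc i)"
  define h where "h = Transposition.transpose i (Suc i)"
  define R where "R = insert (Suc i, i) (pairs n)"
  let ?G = "\<lambda>x. [:binom_det n n x:]"
  have h: "inj h" by (simp add: h_def)
  have sub: "map_prod h h ` R \<subseteq> R"
    using i by (auto simp: R_def h_def pairs_def Transposition.transpose_def split: if_splits)
  have "R = map_prod h h ` R"
  proof
    have "p = map_prod h h (map_prod h h p)" for p
      by (cases p) (simp add: h_def)
    then show "R \<subseteq> map_prod h h ` R" using sub by blast
  qed (rule sub)
  have "x \<circ> h = x"
    using i by (auto simp: h_def fun_eq_iff Transposition.transpose_def)
  then have "ops R ?G x = ops R ?G (x \<circ> h)" by simp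
  also have "\<dots> = ops (map_prod h h ` R) (\<lambda>x. ?G (x \<circ> h)) x"
    using ops_reindex[OF h, of R ?G] by (simp add: R_def fun_eq_iff)
  also have "(\<lambda>x. ?G (x \<circ> h)) = (\<lambda>x. - 1 * ?G x)"
    using i by (simp add: h_def binom_det_transpose)
  also have "ops (map_prod h h ` R) (\<lambda>x. - 1 * ?G x) x = - ops R ?G x"
    unfolding \<open>R = map_prod h h ` R\<close>[symmetric] by (subst ops_scale) (simp_all add: R_def)
  finally have "ops R ?G x = 0" by simp
  moreover have "(Suc i, i) \<notin> pairs n" by (simp add: pairs_def)
  ultimately show "factor_op (Suc i) i (ops (pairs n) ?G) x = 0"
    by (simp add: R_def ops_insert)
qed

section \<open>Pairs of variables containing a given one\<close>

definition skip_pair :: "nat \<Rightarrow> nat \<Rightarrow> nat \<times> nat" where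
  "skip_pair r i = (if i < r then (i, r) else (r, Suc i))"

lemma inj_skip: "inj (skip r)"
  by (auto simp: inj_def skip_def split: if_splits)

text \<open>The function pulled back along \<open>skip r\<close> does not depend on the variable \<open>r\<close>, so the shift
  in that variable acts on it as the identity.\<close>

lemma factor_op_skip_pair:
  "case_prod factor_op (skip_pair r i) (\<lambda>x. f (x \<circ> skip r)) =
     (\<lambda>x. (if i < r then - 1 else 1) * corner r i f (x \<circ> skip r))"
proof -
  let ?F = "\<lambda>f x. f (x \<circ> skip r) :: rat poly"
  have upd: "x(r := v) \<circ> skip r = x \<circ> skip r"
    "j < r \<Longrightarrow> x(j := v) \<circ> skip r = (x \<circ> skip r)(j := v)"
    "r \<le> j \<Longrightarrow> x(Suc j := v) \<circ> skip r = (x \<circ> skip r)(j := v)" for x :: "nat \<Rightarrow> rat" and v j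
    by (auto simp: skip_def fun_eq_iff)
  have shift: "shift r (?F f) = ?F f"
    "j < r \<Longrightarrow> shift j (?F f) = ?F (shift j f)"
    "r \<le> j \<Longrightarrow> shift (Suc j) (?F f) = ?F (shift j f)" for j f
    by (simp_all add: shift_def upd) (simp_all add: skip_def)
  \<comment> \<open>With the shift in \<open>r\<close> trivial, \<open>factor_op i r\<close> becomes
    \<open>f - (1 - Q) * shift i f\<close> and \<open>factor_op r (Suc i)\<close> becomes
    \<open>shift i f - (1 - Q) * f\<close>, read along \<open>skip r\<close>.\<close>
  show ?thesis
    by (auto simp: factor_op_def shift skip_pair_def corner_def algebra_simps)
qed

text \<open>The exponent counts the \<open>i\<close> in \<open>{1..m}\<close> with
  \<open>i < r\<close>, each of which contributes a factor \<open>- 1\<close>.\<close>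

lemma ops_skip_pairs:
  "ops (skip_pair r ` {1..m}) (\<lambda>x. f (x \<circ> skip r)) =
     (\<lambda>x. (- 1) ^ min m (r - 1) * corners r m f (x \<circ> skip r))"
proof (induction m arbitrary: f)
  case (Suc m)
  let ?p = "skip_pair r (Suc m)" and ?c = "if Suc m < r then - 1 else 1 :: rat poly"
  have new: "?p \<notin> skip_pair r ` {1..m}"
    by (auto simp: skip_pair_def split: if_splits)
  have "skip_pair r ` {1..Suc m} = skip_pair r ` {1..m} \<union> {?p}"
    by (simp add: atLeastAtMostSuc_conv)
  moreover have "ops (skip_pair r ` {1..m} \<union> {?p}) (\<lambda>x. f (x \<circ> skip r)) =
      ops (skip_pair r ` {1..m}) (ops {?p} (\<lambda>x. f (x \<circ> skip r)))"
    using new by (intro ops_union) simp_all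
  ultimately have "ops (skip_pair r ` {1..Suc m}) (\<lambda>x. f (x \<circ> skip r)) =
      ops (skip_pair r ` {1..m}) (ops {?p} (\<lambda>x. f (x \<circ> skip r)))"
    by (simp only:)
  also have "ops {?p} (\<lambda>x. f (x \<circ> skip r)) = (\<lambda>x. ?c * corner r (Suc m) f (x \<circ> skip r))"
    by (subst factor_op_skip_pair[symmetric]) (cases ?p; simp add: ops_insert)
  also have "ops (skip_pair r ` {1..m}) \<dots> =
      (\<lambda>x. ?c * ((- 1) ^ min m (r - 1) * corners r (Suc m) f (x \<circ> skip r)))"
    by (subst ops_scale, simp) (simp only: Suc.IH[of "corner r (Suc m) f"] corners.simps)
  also have "\<dots> = (\<lambda>x. (- 1) ^ min (Suc m) (r - 1) * corners r (Suc m) f (x \<circ> skip r))"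
  proof (cases "Suc m < r")
    case True
    then have "min (Suc m) (r - 1) = Suc m" "min m (r - 1) = m" by auto
    with True show ?thesis by (simp del: corners.simps)
  next
    case False
    then have "min (Suc m) (r - 1) = r - 1" "min m (r - 1) = r - 1" by auto
    with False show ?thesis by (simp del: corners.simps)
  qed
  finally show ?case .
qed simp

lemma pairs_Suc:
  assumes "1 \<le> r" "r \<le> Suc n"
  shows "pairs (Suc n) = map_prod (skip r) (skip r) ` pairs n \<union> skip_pair r ` {1..n}"
    and "map_prod (skip r) (skip r) ` pairs n \<inter> skip_pair r ` {1..n} = {}"
proof -
  have ne: "skip r i \<noteq> r" for i by (simp add: skip_def)
  then show "map_prod (skip r) (skip r) ` pairs n \<inter> skip_pair r ` {1..n} = {}"
    by (auto simp: skip_pair_def split: if_splits)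
  have "(s, t) \<in> map_prod (skip r) (skip r) ` pairs n \<union> skip_pair r ` {1..n}"
    if "(s, t) \<in> pairs (Suc n)" for s t
  proof -
    \<comment> \<open>\<open>d\<close> inverts \<open>skip r\<close> on the indices other than
      \<open>r\<close>.\<close>
    define d where "d i = (if i < r then i else i - 1)" for i
    consider "t = r" | "s = r" | "s \<noteq> r" "t \<noteq> r" by blast
    then show ?thesis
    proof cases
      case 1
      then have "(s, t) = skip_pair r s" "s \<in> {1..n}"
        using that assms by (auto simp: skip_pair_def pairs_def)
      then show ?thesis by blast
    next
      case 2
      then have "(s, t) = skip_pair r (t - 1)" "t - 1 \<in> {1..n}"
        using that assms by (auto simp: skip_pair_def pairs_def)
      then show ?thesis by blast
    next
      case 3
      then have "(s, t) = map_prod (skip r) (skip r) (d s, d t)" "(d s, d t) \<in> pairs n"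
        using that assms by (auto simp: skip_def d_def pairs_def)
      then show ?thesis by blast
    qed
  qed
  moreover have "map_prod (skip r) (skip r) ` pairs n \<union> skip_pair r ` {1..n} \<subseteq> pairs (Suc n)"
    using assms by (auto simp: pairs_def skip_def skip_pair_def)
  ultimately show "pairs (Suc n) = map_prod (skip r) (skip r) ` pairs n \<union> skip_pair r ` {1..n}"
    by (intro equalityI subrelI) auto
qed

text \<open>On the \<open>r\<close>-th term of \<open>binom_det_expand\<close> the pairs avoiding
  \<open>r\<close> rebuild \<open>ops (pairs n)\<close> and those containing \<open>r\<close> give
  \<open>corners\<close>. The sign \<open>(- 1) ^ (r - 1)\<close> of the latter cancels that of the
  expansion.\<close>

lemma ops_binom_det_Suc:
  "ops (pairs (Suc n)) (\<lambda>x. [:binom_det 0 (Suc n) x:]) x =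
     (\<Sum>r\<in>{1..Suc n}. corners r n (ops (pairs n) (\<lambda>x. [:binom_det n n x:])) (x \<circ> skip r))"
proof -
  let ?G = "\<lambda>x. [:binom_det n n x:]"
  have "[:\<Sum>r\<in>I. f r:] = (\<Sum>r\<in>I. [:f r:])" for I :: "nat set" and f :: "nat \<Rightarrow> rat"
    by (rule poly_eqI) (simp add: coeff_sum coeff_pCons split: nat.split)
  moreover have "[:(- 1) ^ r * c:] = (- 1) ^ r * [:c:]" for r and c :: rat
    by (cases "even r") simp_all
  ultimately have "(\<lambda>x. [:binom_det 0 (Suc n) x:]) =
      (\<lambda>x. \<Sum>r\<in>{1..Suc n}. (- 1) ^ (r - 1) * ?G (x \<circ> skip r))"
    unfolding binom_det_expand by (simp only:)
  then have "ops (pairs (Suc n)) (\<lambda>x. [:binom_det 0 (Suc n) x:]) x =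
      (\<Sum>r\<in>{1..Suc n}. (- 1) ^ (r - 1) * ops (pairs (Suc n)) (\<lambda>x. ?G (x \<circ> skip r)) x)"
    using ops_sum[of "pairs (Suc n)" "\<lambda>r. (- 1) ^ (r - 1)" "\<lambda>r x. ?G (x \<circ> skip r)" "{1..Suc n}"]
    by simp
  also have "\<dots> = (\<Sum>r\<in>{1..Suc n}. corners r n (ops (pairs n) ?G) (x \<circ> skip r))"
  proof (rule sum.cong)
    fix r assume "r \<in> {1..Suc n}"
    then have r: "1 \<le> r" "r \<le> Suc n" by auto
    note pairs = pairs_Suc[OF r]
    have "ops (pairs (Suc n)) (\<lambda>x. ?G (x \<circ> skip r)) =
        ops (skip_pair r ` {1..n}) (ops (map_prod (skip r) (skip r) ` pairs n) (\<lambda>x. ?G (x \<circ> skip r)))"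
      unfolding pairs(1) by (subst Un_commute, rule ops_union) (use pairs(2) in auto)
    also have "ops (map_prod (skip r) (skip r) ` pairs n) (\<lambda>x. ?G (x \<circ> skip r)) =
        (\<lambda>x. ops (pairs n) ?G (x \<circ> skip r))"
      by (rule ops_reindex[symmetric]) (simp_all add: inj_skip)
    also have "ops (skip_pair r ` {1..n}) \<dots> =
        (\<lambda>x. (- 1) ^ min n (r - 1) * corners r n (ops (pairs n) ?G) (x \<circ> skip r))"
      by (rule ops_skip_pairs)
    finally have "ops (pairs (Suc n)) (\<lambda>x. ?G (x \<circ> skip r)) x =
        (- 1) ^ min n (r - 1) * corners r n (ops (pairs n) ?G) (x \<circ> skip r)"
      by (rule fun_cong)
    moreover have "min n (r - 1) = r - 1" using r by auto
    moreover have "(- 1) ^ m * ((- 1) ^ m * c) = c" for m and c :: "rat poly"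
      by (simp add: mult.assoc[symmetric] power_mult_distrib[symmetric])
    ultimately show "(- 1) ^ (r - 1) * ops (pairs (Suc n)) (\<lambda>x. ?G (x \<circ> skip r)) x =
        corners r n (ops (pairs n) ?G) (x \<circ> skip r)"
      by (simp only:)
  qed simp
  finally show ?thesis .
qed

text \<open>The differences commute with the operator and turn \<open>binom_det n n\<close> into
  \<open>binom_det 0 n\<close>, so the row sum telescopes to corner terms, which
  \<open>ops_binom_det_Suc\<close> reassembles.\<close>

lemma ops_binom_det_interlacing:
  assumes "\<And>i. 1 \<le> i \<Longrightarrow> i \<le> n \<Longrightarrow> k i < k (Suc i)" "\<And>i. i \<notin> {1..Suc n} \<Longrightarrow> k i = 0"
  shows "row_sum n k (ops (pairs n) (\<lambda>x. [:binom_det 0 n x:])) =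
    ops (pairs (Suc n)) (\<lambda>x. [:binom_det 0 (Suc n) x:]) (\<lambda>i. of_int (k i))"
proof -
  let ?B = "ops (pairs n) (\<lambda>x. [:binom_det n n x:])"
  have "row_sum n k (ops (pairs n) (\<lambda>x. [:binom_det 0 n x:])) = row_sum n k (differences n ?B)"
    by (simp add: differences_ops differences_binom_det)
  also have "\<dots> = (\<Sum>r\<in>{1..Suc n}. corner_term k r n ?B)"
    by (rule row_sum_differences[of n k, OF assms(1) shift_antisym_ops_binom_det])
  also have "\<dots> = (\<Sum>r\<in>{1..Suc n}. corners r n ?B ((\<lambda>i. of_int (k i)) \<circ> skip r))"
  proof (rule sum.cong)
    fix r assume r: "r \<in> {1..Suc n}"
    \<comment> \<open>This makes the default 0 in \<open>corner_term\<close> agree with the zeros of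
      \<open>k\<close>.\<close>
    then have "skip r i \<notin> {1..Suc n}" if "i \<notin> {1..n}" for i
      using that by (auto simp: skip_def)
    then have "(\<lambda>i. if i \<in> {1..n} then of_int (k (skip r i)) else 0) =
        (\<lambda>i. rat_of_int (k i)) \<circ> skip r"
      using assms(2) by (auto simp: fun_eq_iff)
    then show "corner_term k r n ?B = corners r n ?B ((\<lambda>i. of_int (k i)) \<circ> skip r)"
      by (simp only: corner_term_def)
  qed simp
  finally show ?thesis by (simp only: ops_binom_det_Suc)
qed

lemma monotone_triangles_1:
  "monotone_triangles (Suc 0) k = {\<lambda>i j. if i = 1 \<and> j = 1 then k 1 else 0}"
  by (auto simp: monotone_triangles_def monotone_triangle_def fun_eq_iff)

text \<open>Rows in \<open>interlacing n k\<close> again increase strictly and vanish off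
  \<open>{1..n}\<close>, so the induction hypothesis applies to each of them.\<close>

lemma operator_formula:
  assumes "n \<ge> 1" "\<And>i. 1 \<le> i \<Longrightarrow> i < n \<Longrightarrow> k i < k (Suc i)" "\<And>i. i \<notin> {1..n} \<Longrightarrow> k i = 0"
  shows "(\<Sum>T\<in>monotone_triangles n k. Q ^ triangle_inv n T) =
    ops (pairs n) (\<lambda>x. [:binom_det 0 n x:]) (\<lambda>i. of_int (k i))"
  using assms
proof (induction n arbitrary: k rule: dec_induct)
  case base
  have "{(i, j). 1 < i \<and> i \<le> j \<and> j \<le> Suc 0 \<and> P i j} = {}" for P :: "nat \<Rightarrow> nat \<Rightarrow> bool"
    by auto
  then have "triangle_inv (Suc 0) T = 0" for T
    by (simp only: triangle_inv_def card.empty)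
  moreover have "pairs (Suc 0) = {}" by (auto simp: pairs_def)
  ultimately show ?case
    by (simp add: monotone_triangles_1 binom_det_vandermonde)
next
  case (step n)
  have "(\<Sum>T\<in>monotone_triangles (Suc n) k. Q ^ triangle_inv (Suc n) T) =
    (\<Sum>l\<in>interlacing n k. weight n k l * (\<Sum>T\<in>monotone_triangles n l. Q ^ triangle_inv n T))"
    using step.hyps(1) step.prems by (intro sum_monotone_triangles_Suc) auto
  also have "\<dots> = row_sum n k (ops (pairs n) (\<lambda>x. [:binom_det 0 n x:]))"
    unfolding row_sum_def
    by (rule sum.cong) (auto simp: interlacing_def intro!: arg_cong2[of _ _ _ _ "(*)"] step.IH)
  also have "\<dots> = ops (pairs (Suc n)) (\<lambda>x. [:binom_det 0 (Suc n) x:]) (\<lambda>i. of_int (k i))"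
    using step.prems by (intro ops_binom_det_interlacing) auto
  finally show ?case .
qed

theorem theorem1:
  fixes n :: nat and k :: "nat \<Rightarrow> int"
  assumes "n \<ge> 1"
    and "strict_mono_on {1..n} k"
  shows "(\<Sum>T\<in>monotone_triangles n k. Q ^ triangle_inv n T) =
         product_op n (vandermonde_poly n) (\<lambda>i. of_int (k i))"
proof -
  \<comment> \<open>Both sides depend only on \<open>k\<close> on \<open>{1..n}\<close>, so it may
    be set to zero elsewhere.\<close>
  define k' where "k' = (\<lambda>i. if i \<in> {1..n} then k i else 0)"
  have "monotone_triangles n k = monotone_triangles n k'"
    by (simp add: monotone_triangles_def k'_def)
  moreover have "(\<Sum>T\<in>monotone_triangles n k'. Q ^ triangle_inv n T) =
      ops (pairs n) (\<lambda>x. [:binom_det 0 n x:]) (\<lambda>i. of_int (k' i))"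
    using assms by (intro operator_formula) (auto simp: k'_def strict_mono_on_def)
  moreover have "(\<lambda>i. rat_of_int (k' i)) = (\<lambda>i. if i \<in> {1..n} then of_int (k i) else 0)"
    by (auto simp: k'_def)
  moreover have "ops (pairs n) (\<lambda>x. [:binom_det 0 n x:]) (\<lambda>i. if i \<in> {1..n} then of_int (k i) else 0) =
      ops (pairs n) (\<lambda>x. [:binom_det 0 n x:]) (\<lambda>i. of_int (k i))"
  proof (rule ops_restrict)
    fix x :: "nat \<Rightarrow> rat"
    show "[:binom_det 0 n (\<lambda>i. if i \<in> {1..n} then x i else 0):] = [:binom_det 0 n x:]"
      unfolding binom_det_def by (intro arg_cong[of _ _ "\<lambda>A. [:det A:]"]) auto
  qed
  ultimately show ?thesis
    unfolding product_op_eq_ops vandermonde_poly_eq by (simp only:)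
qed

end
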